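(* Let $I\subset\mathbb R$ be an interval and let $\mathbf r=(x,y,z):I\to\mathbb H_1$ be a smooth horizontally regular curve parametrized by horizontal arc length $s$, with adapted frame $\{\mathbf t,\mathbf n,\mathbf b\}$, $p$-curvature $\kappa$ and contact normality $\tau$. \begin{enumerate} \item If $\mathbf r(s)\in\operatorname{span}\{\mathbf t(s),\mathbf n(s)\}$ for all $s$, then $\mathbf r$ lies in the $xy$-plane. More precisely: (a) if $\kappa\equiv0$, then $\mathbf r$ is contained in a straight line in the $xy$-plane; (b) if $\kappa\not\equiv0$, then $\mathbf r$ is a nonlinear planar curve in the $xy$-plane. \item If $\mathbf r(s)\in\operatorname{span}\{\mathbf t(s),\mathbf b(s)\}$ for all $s$, then $\kappa\equiv0$ and $\mathbf r$ lies in a vertical plane through the $z$-axis. \item If $\mathbf r(s)\in\operatorname{span}\{\mathbf n(s),\mathbf b(s)\}$ for all $s$, then $\kappa$ is a nonzero constant, the projection of $\mathbf r$ onto the $xy$-plane lies on a circle, and $\mathbf r$ lies on a circular cylinder about the $z$-axis. Moreover, the height satisfies $z(s)=As+B$ for some constants $A,B\in\mathbb R$ if and only if $\tau$ is constant. In the case that $\tau$ is constant: if $z$ is constant, then the curve is a planar circle; if $z$ is nonconstant, then the curve is a nondegenerate circular helix. \end{enumerate}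
   Context: The Heisenberg group $\mathbb H_1$ is identified with $\mathbb R^3$ through its standard coordinates $(x,y,z)$; left translation by $(x,y,z)$ is $(a,b,c)\mapsto(a+x,b+y,c+z+ya-xb)$. The standard left-invariant frame at $(x,y,z)$ is $\mathring{\mathbf e}_1=(1,0,y)$, $\mathring{\mathbf e}_2=(0,1,-x)$, $\mathbf T=(0,0,1)$, and the contact form is $\Theta=dz+x\,dy-y\,dx$. The metric $\langle\cdot,\cdot\rangle$ is the one making $\{\mathring{\mathbf e}_1,\mathring{\mathbf e}_2,\mathbf T\}$ orthonormal. A smooth curve $\mathbf r=(x,y,z)$ is horizontally regular if $(x')^2+(y')^2\neq0$ everywhere; it is parametrized by horizontal arc length if $(x')^2+(y')^2\equiv1$. For such a parametrization the adapted frame, written in the coordinates of $\mathbb R^3$, is $$\mathbf t=x'\mathring{\mathbf e}_1+y'\mathring{\mathbf e}_2=(x',y',x'y-xy'),\quad \mathbf n=-y'\mathring{\mathbf e}_1+x'\mathring{\mathbf e}_2=(-y',x',-yy'-xx'),\quad \mathbf b=\mathbf T=(0,0,1).$$ The $p$-curvature is $\kappa=\langle\mathbf t',\mathbf n\rangle=x'y''-x''y'$ and the contact normality is $\tau=\Theta(\mathbf r')=xy'-x'y+z'$. The position vector of $\mathbf r$ is the vector $(x,y,z)\in\mathbb R^3$, and "$\mathbf r(s)\in\operatorname{span}\{\cdot,\cdot\}$" means that this vector lies in the linear span in $\mathbb R^3$ of the two frame vectors at parameter $s$. Terminology: the $xy$-plane is $\{z=0\}$; a nonlinear planar curve is one not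 contained in a straight line; a circular cylinder about the $z$-axis is a set $\{x^2+y^2=\rho^2\}$, $\rho>0$; a planar circle means that the curve traces (an arc of) a circle in a plane $z=\text{const}$; a nondegenerate circular helix is a curve (or arc) lying on a circular cylinder whose $xy$-projection moves along the circle with constant nonzero angular speed and whose height is affine in $s$ with nonzero slope. *)

theory Defs
  imports "HOL-Analysis.Analysis"
begin

text \<open>The Heisenberg group is \<open>real ^ 3\<close> with its standard coordinates; tangent vectors
  are written in the same coordinates.\<close>

definition frame_e1 :: "real ^ 3 \<Rightarrow> real ^ 3" where
  "frame_e1 p = vector [1, 0, p $ 2]"

definition frame_e2 :: "real ^ 3 \<Rightarrow> real ^ 3" where
  "frame_e2 p = vector [0, 1, - (p $ 1)]"

definition frame_T :: "real ^ 3" where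
  "frame_T = vector [0, 0, 1]"

definition contact_form :: "real ^ 3 \<Rightarrow> real ^ 3 \<Rightarrow> real" where
  "contact_form p v = v $ 3 + p $ 1 * v $ 2 - p $ 2 * v $ 1"

text \<open>The coframe dual to \<^const>\<open>frame_e1\<close>, \<^const>\<open>frame_e2\<close>, \<^const>\<open>frame_T\<close> is
  \<open>dx, dy, \<Theta>\<close>, so the metric making the frame orthonormal is \<open>dx\<^sup>2 + dy\<^sup>2 + \<Theta>\<^sup>2\<close>.\<close>

definition heis_metric :: "real ^ 3 \<Rightarrow> real ^ 3 \<Rightarrow> real ^ 3 \<Rightarrow> real" where
  "heis_metric p v w = v $ 1 * w $ 1 + v $ 2 * w $ 2 + contact_form p v * contact_form p w"

lemma bilinear_heis_metric: "bilinear (heis_metric p)"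
  by (auto simp: bilinear_def heis_metric_def contact_form_def algebra_simps intro!: linearI)

lemma heis_metric_orthonormal:
  "heis_metric p (frame_e1 p) (frame_e1 p) = 1"
  "heis_metric p (frame_e2 p) (frame_e2 p) = 1"
  "heis_metric p frame_T frame_T = 1"
  "heis_metric p (frame_e1 p) (frame_e2 p) = 0"
  "heis_metric p (frame_e1 p) frame_T = 0"
  "heis_metric p (frame_e2 p) frame_T = 0"
  by (simp_all add: heis_metric_def contact_form_def frame_e1_def frame_e2_def frame_T_def vector_3)

text \<open>Curves live on an interval \<open>I\<close> that may contain its endpoints, so every derivative is
  taken within \<open>I\<close> (one-sided at an endpoint).\<close>

definition curve_deriv :: "real set \<Rightarrow> (real \<Rightarrow> 'a::real_normed_vector) \<Rightarrow> real \<Rightarrow> 'a" where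
  "curve_deriv I f s = vector_derivative f (at s within I)"

definition smooth_curve :: "real set \<Rightarrow> (real \<Rightarrow> 'a::real_normed_vector) \<Rightarrow> bool" where
  "smooth_curve I f \<longleftrightarrow> (\<forall>n. (curve_deriv I ^^ n) f differentiable_on I)"

definition horizontally_regular :: "real set \<Rightarrow> (real \<Rightarrow> real ^ 3) \<Rightarrow> bool" where
  "horizontally_regular I r \<longleftrightarrow>
     (\<forall>s\<in>I. (curve_deriv I r s $ 1)\<^sup>2 + (curve_deriv I r s $ 2)\<^sup>2 \<noteq> 0)"

definition horizontal_arc_length :: "real set \<Rightarrow> (real \<Rightarrow> real ^ 3) \<Rightarrow> bool" where
  "horizontal_arc_length I r \<longleftrightarrow>
     (\<forall>s\<in>I. (curve_deriv I r s $ 1)\<^sup>2 + (curve_deriv I r s $ 2)\<^sup>2 = 1)"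

definition frame_t :: "real set \<Rightarrow> (real \<Rightarrow> real ^ 3) \<Rightarrow> real \<Rightarrow> real ^ 3" where
  "frame_t I r s = (curve_deriv I r s $ 1) *\<^sub>R frame_e1 (r s)
                 + (curve_deriv I r s $ 2) *\<^sub>R frame_e2 (r s)"

definition frame_n :: "real set \<Rightarrow> (real \<Rightarrow> real ^ 3) \<Rightarrow> real \<Rightarrow> real ^ 3" where
  "frame_n I r s = - (curve_deriv I r s $ 2) *\<^sub>R frame_e1 (r s)
                 + (curve_deriv I r s $ 1) *\<^sub>R frame_e2 (r s)"

definition frame_b :: "real set \<Rightarrow> (real \<Rightarrow> real ^ 3) \<Rightarrow> real \<Rightarrow> real ^ 3" where
  "frame_b I r s = frame_T"

text \<open>The derivative of \<open>t\<close> is taken in the coordinates of \<open>real ^ 3\<close>; it agrees with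
  differentiating the coefficients of \<open>t\<close> in the left-invariant frame, because the two extra
  terms cancel in the third coordinate (see \<open>p_curvature_eq\<close> below).\<close>

definition p_curvature :: "real set \<Rightarrow> (real \<Rightarrow> real ^ 3) \<Rightarrow> real \<Rightarrow> real" where
  "p_curvature I r s = heis_metric (r s) (curve_deriv I (frame_t I r) s) (frame_n I r s)"

definition contact_normality :: "real set \<Rightarrow> (real \<Rightarrow> real ^ 3) \<Rightarrow> real \<Rightarrow> real" where
  "contact_normality I r s = contact_form (r s) (curve_deriv I r s)"

lemma frame_t_coords:
  "frame_t I r s = vector [curve_deriv I r s $ 1, curve_deriv I r s $ 2,
     curve_deriv I r s $ 1 * r s $ 2 - r s $ 1 * curve_deriv I r s $ 2]"
  by (simp add: vec_eq_iff forall_3 vector_3 frame_t_def frame_e1_def frame_e2_def algebra_simps)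

lemma frame_n_coords:
  "frame_n I r s = vector [- curve_deriv I r s $ 2, curve_deriv I r s $ 1,
     - (r s $ 2 * curve_deriv I r s $ 2) - r s $ 1 * curve_deriv I r s $ 1]"
  by (simp add: vec_eq_iff forall_3 vector_3 frame_n_def frame_e1_def frame_e2_def algebra_simps)

lemma p_curvature_eq:
  assumes I: "is_interval I" "interior I \<noteq> {}" and r: "smooth_curve I r" and s: "s \<in> I"
  defines "r' \<equiv> curve_deriv I r s" and "r'' \<equiv> curve_deriv I (curve_deriv I r) s"
  shows "p_curvature I r s = r' $ 1 * r'' $ 2 - r'' $ 1 * r' $ 2"
proof -
  have "\<not> (\<exists>a. I = {a})" using I(2) by auto
  with I(1) s have nb: "at s within I \<noteq> bot"
    using connected_imp_perfect[of I s] is_interval_connected[of I]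
    by (auto simp: trivial_limit_within)
  have d: "(curve_deriv I ^^ n) r differentiable at s within I" for n
    using r s by (auto simp: smooth_curve_def differentiable_on_def)
  have d0: "(r has_vector_derivative r') (at s within I)"
    using d[of 0] by (simp add: r'_def curve_deriv_def vector_derivative_works)
  have d1: "(curve_deriv I r has_vector_derivative r'') (at s within I)"
    using d[of 1] unfolding r''_def curve_deriv_def[of I "curve_deriv I r"]
    by (simp add: vector_derivative_works)
  have c: "((\<lambda>u. g u $ i) has_real_derivative g' $ i) (at s within I)"
    if "(g has_vector_derivative g') (at s within I)" for g :: "real \<Rightarrow> real ^ 3" and g' i
    using bounded_linear.has_vector_derivative[OF bounded_linear_vec_nth that]
    by (simp add: has_real_derivative_iff_has_vector_derivative)
  let ?g = "vector [r'' $ 1, r'' $ 2, r'' $ 1 * r s $ 2 - r s $ 1 * r'' $ 2] :: real ^ 3"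
  have "(frame_t I r has_vector_derivative ?g) (at s within I)"
    unfolding has_vector_derivative_def
  proof (subst has_derivative_componentwise_within, intro ballI)
    fix b :: "real ^ 3" assume "b \<in> Basis"
    then obtain i where b: "b = axis i 1" by (auto simp: Basis_vec_def)
    have "((\<lambda>u. frame_t I r u $ i) has_real_derivative ?g $ i) (at s within I)"
    proof -
      have "((\<lambda>u. curve_deriv I r u $ 1 * r u $ 2 - r u $ 1 * curve_deriv I r u $ 2)
          has_real_derivative r'' $ 1 * r s $ 2 - r s $ 1 * r'' $ 2) (at s within I)"
        by (rule derivative_eq_intros c[OF d0] c[OF d1] refl)+
          (simp add: r'_def algebra_simps)
      moreover have "i = 1 \<or> i = 2 \<or> i = 3" by (rule exhaust_3)
      ultimately show ?thesis
        using c[OF d1, of 1] c[OF d1, of 2] by (auto simp: frame_t_coords vector_3)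
    qed
    then show "((\<lambda>u. frame_t I r u \<bullet> b) has_derivative (\<lambda>u. (u *\<^sub>R ?g) \<bullet> b)) (at s within I)"
      by (simp add: b inner_axis has_field_derivative_def mult_commute_abs)
  qed
  then have "curve_deriv I (frame_t I r) s = ?g"
    unfolding curve_deriv_def by (rule vector_derivative_within[OF nb])
  then show ?thesis
    by (simp add: p_curvature_def heis_metric_def contact_form_def frame_n_coords vector_3
        r'_def algebra_simps)
qed

definition xy_plane :: "(real ^ 3) set" where
  "xy_plane = {p. p $ 3 = 0}"

definition is_line :: "(real ^ 3) set \<Rightarrow> bool" where
  "is_line L \<longleftrightarrow> (\<exists>p q. p \<noteq> q \<and> L = affine hull {p, q})"

definition nonlinear_planar_curve_in :: "(real ^ 3) set \<Rightarrow> real set \<Rightarrow> (real \<Rightarrow> real ^ 3) \<Rightarrow> bool" where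
  "nonlinear_planar_curve_in P I r \<longleftrightarrow> r ` I \<subseteq> P \<and> \<not> (\<exists>L. is_line L \<and> r ` I \<subseteq> L)"

definition vertical_plane_through_z_axis :: "(real ^ 3) set \<Rightarrow> bool" where
  "vertical_plane_through_z_axis P \<longleftrightarrow>
     (\<exists>\<alpha> \<beta>. (\<alpha> \<noteq> 0 \<or> \<beta> \<noteq> 0) \<and> P = {p. \<alpha> * p $ 1 + \<beta> * p $ 2 = 0})"

definition xy_proj :: "real ^ 3 \<Rightarrow> real ^ 2" where
  "xy_proj p = vector [p $ 1, p $ 2]"

definition z_cylinder :: "real \<Rightarrow> (real ^ 3) set" where
  "z_cylinder \<rho> = {p. (p $ 1)\<^sup>2 + (p $ 2)\<^sup>2 = \<rho>\<^sup>2}"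

text \<open>The trace of the curve is exactly an arc (angles in a nondegenerate interval \<open>J\<close>, possibly
  covering the whole circle) of a circle in a plane \<open>z = h\<close>.\<close>

definition planar_circle :: "real set \<Rightarrow> (real \<Rightarrow> real ^ 3) \<Rightarrow> bool" where
  "planar_circle I r \<longleftrightarrow>
     (\<exists>a b h \<rho> J. \<rho> > 0 \<and> is_interval J \<and> interior J \<noteq> {} \<and>
        r ` I = (\<lambda>\<theta>::real. vector [a + \<rho> * cos \<theta>, b + \<rho> * sin \<theta>, h]) ` J)"

text \<open>\<open>\<omega>\<close> is the signed constant angular speed of the projection and \<open>A\<close> the slope of the height.\<close>

definition nondegenerate_circular_helix :: "real set \<Rightarrow> (real \<Rightarrow> real ^ 3) \<Rightarrow> bool" where
  "nondegenerate_circular_helix I r \<longleftrightarrow>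
     (\<exists>\<rho> \<omega> \<phi> A B. \<rho> > 0 \<and> \<omega> \<noteq> 0 \<and> A \<noteq> 0 \<and>
        (\<forall>s\<in>I. r s = vector [\<rho> * cos (\<omega> * s + \<phi>), \<rho> * sin (\<omega> * s + \<phi>), A * s + B]))"

end

theory Submission
  imports Defs
begin

text \<open>
  In all three cases the span condition expresses the position through \<open>a = x x' + y y'\<close> and
  \<open>b = y x' - x y'\<close>, and for a unit speed plane curve of curvature \<open>\<kappa>\<close> one has
  \<open>a' = 1 + \<kappa> b\<close> and \<open>b' = - \<kappa> a\<close>.
  If \<open>r = a t + b n\<close>, the third coordinate is \<open>a b - b a = 0\<close>.
  If \<open>b = 0\<close>, then \<open>\<kappa> a = 0\<close> and \<open>a' = 1\<close>, so differentiating once more gives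
  \<open>\<kappa> = 0\<close> also at the possible zero of \<open>a\<close>.
  If \<open>a = 0\<close>, then \<open>b\<close> is constant with \<open>\<kappa> b = -1\<close>, so the projection is a uniform
  rotation about the origin, and \<open>\<tau> = z' - b\<close> differs from \<open>z'\<close> by a constant.
\<close>

section \<open>Derivatives within an interval\<close>

lemma at_within_interval_neq_bot:
  fixes I :: "real set"
  assumes "is_interval I" "interior I \<noteq> {}" "s \<in> I"
  shows "at s within I \<noteq> bot"
proof -
  have "\<not> (\<exists>a. I = {a})"
    using assms(2) by auto
  then show ?thesis
    using assms connected_imp_perfect[of I s] is_interval_connected[of I]
    by (auto simp: trivial_limit_within)
qed

text \<open>This is the device for differentiating identities that hold only on \<open>I\<close>:
  derivatives within \<open>I\<close> ignore values outside it, and they are unique because an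
  interval with nonempty interior has no isolated point.\<close>

lemma has_real_derivative_unique_on:
  fixes f g :: "real \<Rightarrow> real"
  assumes "is_interval I" "interior I \<noteq> {}" "s \<in> I"
    and f: "(f has_real_derivative a) (at s within I)"
    and g: "(g has_real_derivative b) (at s within I)"
    and eq: "\<And>u. u \<in> I \<Longrightarrow> f u = g u"
  shows "a = b"
proof -
  have "(f has_real_derivative b) (at s within I)"
    using g has_derivative_transform[OF \<open>s \<in> I\<close> eq] by (auto simp: has_field_derivative_def)
  with f show ?thesis
    using vector_derivative_unique_within[OF at_within_interval_neq_bot[OF assms(1-3)]]
    by (auto simp: has_real_derivative_iff_has_vector_derivative)
qed

section \<open>Unit speed plane curves, applied later to the projection to the first two
  coordinates\<close>

locale unit_speed_plane_curve =
  fixes I :: "real set" and x y x' y' x'' y'' :: "real \<Rightarrow> real"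
  assumes I: "is_interval I" "interior I \<noteq> {}"
    and x: "\<And>s. s \<in> I \<Longrightarrow> (x has_real_derivative x' s) (at s within I)"
    and y: "\<And>s. s \<in> I \<Longrightarrow> (y has_real_derivative y' s) (at s within I)"
    and x': "\<And>s. s \<in> I \<Longrightarrow> (x' has_real_derivative x'' s) (at s within I)"
    and y': "\<And>s. s \<in> I \<Longrightarrow> (y' has_real_derivative y'' s) (at s within I)"
    and unit: "\<And>s. s \<in> I \<Longrightarrow> (x' s)\<^sup>2 + (y' s)\<^sup>2 = 1"
begin

text \<open>The signed curvature of the plane curve; for the projection of \<open>r\<close> it
  coincides with the p-curvature of \<open>r\<close>.\<close>

definition \<kappa> :: "real \<Rightarrow> real" where
  "\<kappa> s = x' s * y'' s - x'' s * y' s"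

lemma deriv_eq:
  assumes "s \<in> I" "(f has_real_derivative a) (at s within I)"
    and "(g has_real_derivative b) (at s within I)" "\<And>u. u \<in> I \<Longrightarrow> f u = g u"
  shows "a = b"
  using has_real_derivative_unique_on[OF I assms] .

lemma zero_deriv_constant:
  assumes "\<And>s. s \<in> I \<Longrightarrow> (f has_real_derivative 0) (at s within I)"
  obtains c where "\<And>s. s \<in> I \<Longrightarrow> f s = c"
  using has_field_derivative_zero_constant[of I f] I(1) assms by (auto simp: is_interval_convex_1)

lemma nonempty: "I \<noteq> {}"
  using I(2) by auto

text \<open>Differentiating \<open>unit\<close> shows that the acceleration is orthogonal to the
  unit velocity, hence a multiple of the normal \<open>(- y', x')\<close>; its inner product with
  that normal is \<kappa>.\<close>

lemma frenet:
  assumes s: "s \<in> I"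
  shows "x'' s = - \<kappa> s * y' s" "y'' s = \<kappa> s * x' s"
proof -
  have "((\<lambda>u. (x' u)\<^sup>2 + (y' u)\<^sup>2) has_real_derivative 2 * (x' s * x'' s + y' s * y'' s))
      (at s within I)"
    by (rule derivative_eq_intros x' y' s refl)+ (simp add: algebra_simps)
  then have "2 * (x' s * x'' s + y' s * y'' s) = 0"
    by (rule deriv_eq[OF s _ DERIV_const unit])
  then have o: "x' s * x'' s + y' s * y'' s = 0"
    by simp
  show "x'' s = - \<kappa> s * y' s" "y'' s = \<kappa> s * x' s"
    using unit[OF s] o unfolding \<kappa>_def by algebra+
qed

lemma deriv_tangential:
  assumes s: "s \<in> I"
  shows "((\<lambda>u. x u * x' u + y u * y' u) has_real_derivative
      1 + \<kappa> s * (y s * x' s - x s * y' s)) (at s within I)"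
  by (rule derivative_eq_intros x y x' y' s refl)+
    (use unit[OF s] in \<open>simp add: frenet[OF s] power2_eq_square algebra_simps\<close>)

lemma deriv_normal:
  assumes s: "s \<in> I"
  shows "((\<lambda>u. y u * x' u - x u * y' u) has_real_derivative
      - \<kappa> s * (x s * x' s + y s * y' s)) (at s within I)"
  by (rule derivative_eq_intros x y x' y' s refl)+
    (simp add: frenet[OF s] algebra_simps)

text \<open>By \<open>frenet\<close> the acceleration vanishes. Constancy of the velocity is kept
  apart from its integrated form because the vertical plane of the second case is read off from the
  direction alone.\<close>

lemma zero_curvature_direction:
  assumes "\<And>s. s \<in> I \<Longrightarrow> \<kappa> s = 0"
  obtains c d where "c\<^sup>2 + d\<^sup>2 = 1" "\<And>s. s \<in> I \<Longrightarrow> x' s = c" "\<And>s. s \<in> I \<Longrightarrow> y' s = d"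
proof -
  obtain c where c: "\<And>s. s \<in> I \<Longrightarrow> x' s = c"
    using zero_deriv_constant[of x'] x' frenet(1) assms by force
  obtain d where d: "\<And>s. s \<in> I \<Longrightarrow> y' s = d"
    using zero_deriv_constant[of y'] y' frenet(2) assms by force
  show ?thesis
    using that[of c d] c d unit nonempty by (metis ex_in_conv)
qed

lemma zero_curvature_line:
  assumes "\<And>s. s \<in> I \<Longrightarrow> \<kappa> s = 0"
  obtains a b c d where "c\<^sup>2 + d\<^sup>2 = 1"
    "\<And>s. s \<in> I \<Longrightarrow> x s = a + c * s" "\<And>s. s \<in> I \<Longrightarrow> y s = b + d * s"
proof -
  obtain c d where cd: "c\<^sup>2 + d\<^sup>2 = 1" "\<And>s. s \<in> I \<Longrightarrow> x' s = c" "\<And>s. s \<in> I \<Longrightarrow> y' s = d"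
    using zero_curvature_direction assms by blast
  have "((\<lambda>s. x s - c * s) has_real_derivative 0) (at s within I)" if "s \<in> I" for s
    by (rule derivative_eq_intros x that refl)+ (simp add: cd that)
  then obtain a where a: "\<And>s. s \<in> I \<Longrightarrow> x s - c * s = a"
    using zero_deriv_constant[of "\<lambda>s. x s - c * s"] by blast
  have "((\<lambda>s. y s - d * s) has_real_derivative 0) (at s within I)" if "s \<in> I" for s
    by (rule derivative_eq_intros y that refl)+ (simp add: cd that)
  then obtain b where b: "\<And>s. s \<in> I \<Longrightarrow> y s - d * s = b"
    using zero_deriv_constant[of "\<lambda>s. y s - d * s"] by blast
  show ?thesis
    using that[of c d a b] cd(1) a b by (simp add: algebra_simps)
qed

text \<open>The parameter \<open>t\<close> is an arbitrary function, so it is eliminated before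
  differentiating: \<open>d (x - p) = c (y - q)\<close> is differentiated twice, and velocity and
  acceleration then satisfy the same linear equation, which forces their determinant \<kappa> to
  vanish.\<close>

lemma zero_curvature_if_in_line:
  assumes line: "\<And>s. s \<in> I \<Longrightarrow> x s = p + t s * c \<and> y s = q + t s * d" and s: "s \<in> I"
  shows "\<kappa> s = 0"
proof -
  have eq: "d * (x u - p) = c * (y u - q)" if "u \<in> I" for u
    using line[OF that] by simp
  have eq': "d * x' u = c * y' u" if u: "u \<in> I" for u
    by (rule deriv_eq[OF u _ _ eq]) (rule derivative_eq_intros x y u refl | simp)+
  have eq'': "d * x'' s = c * y'' s"
    by (rule deriv_eq[OF s _ _ eq']) (rule derivative_eq_intros x' y' s refl | simp)+
  \<comment> \<open>The direction \<open>(c, d)\<close> could be zero if it came from a vertical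
    line in space, but then the projection would stand still, against unit speed.\<close>
  have "c \<noteq> 0 \<or> d \<noteq> 0"
  proof (rule ccontr)
    assume "\<not> (c \<noteq> 0 \<or> d \<noteq> 0)"
    then have xp: "x u = p" "y u = q" if "u \<in> I" for u
      using line[OF that] by simp_all
    have "x' s = 0" "y' s = 0"
      using deriv_eq[OF s x[OF s] DERIV_const xp(1)] deriv_eq[OF s y[OF s] DERIV_const xp(2)]
      by simp_all
    then show False
      using unit[OF s] by simp
  qed
  moreover have "c * \<kappa> s = 0" "d * \<kappa> s = 0"
    using eq'[OF s] eq'' unfolding \<kappa>_def by algebra+
  ultimately show ?thesis
    by auto
qed

text \<open>With \<open>a = x x' + y y'\<close>, the equation \<open>\<kappa> a = 0\<close> says
  nothing where \<open>a\<close> vanishes; its derivative \<open>\<kappa>' a + \<kappa> = 0\<close>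
  settles those points, which is why \<kappa> has to be differentiable.\<close>

lemma zero_curvature_if_radial:
  assumes \<kappa>: "\<And>s. s \<in> I \<Longrightarrow> (\<kappa> has_real_derivative \<kappa>' s) (at s within I)"
    and b: "\<And>s. s \<in> I \<Longrightarrow> y s * x' s - x s * y' s = 0" and s: "s \<in> I"
  shows "\<kappa> s = 0"
proof -
  have \<kappa>a: "\<kappa> u * (x u * x' u + y u * y' u) = 0" if u: "u \<in> I" for u
    using deriv_eq[OF u deriv_normal[OF u] DERIV_const b] by simp
  have a: "((\<lambda>u. x u * x' u + y u * y' u) has_real_derivative 1) (at s within I)"
    using deriv_tangential[OF s] b[OF s] by simp
  have "\<kappa>' s * (x s * x' s + y s * y' s) + 1 * \<kappa> s = 0"
    by (rule deriv_eq[OF s DERIV_mult[OF \<kappa>[OF s] a] DERIV_const \<kappa>a])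
  then show ?thesis
    using \<kappa>a[OF s] by auto
qed

lemma rotation_if_tangential_zero:
  assumes a: "\<And>s. s \<in> I \<Longrightarrow> x s * x' s + y s * y' s = 0"
  obtains k where "k \<noteq> 0" "\<And>s. s \<in> I \<Longrightarrow> \<kappa> s = k"
    "\<And>s. s \<in> I \<Longrightarrow> x' s = - k * y s" "\<And>s. s \<in> I \<Longrightarrow> y' s = k * x s"
    "\<And>s. s \<in> I \<Longrightarrow> y s * x' s - x s * y' s = - 1 / k"
proof -
  obtain b where b: "\<And>s. s \<in> I \<Longrightarrow> y s * x' s - x s * y' s = b"
    using zero_deriv_constant[of "\<lambda>s. y s * x' s - x s * y' s"] deriv_normal a by force
  have \<kappa>b: "\<kappa> s * b = - 1" if s: "s \<in> I" for s
    using deriv_eq[OF s deriv_tangential[OF s] DERIV_const a] b[OF s] by simp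
  have b0: "b \<noteq> 0"
    using \<kappa>b nonempty by fastforce
  \<comment> \<open>Expansion of the position in the orthonormal basis \<open>(x', y')\<close>,
    \<open>(- y', x')\<close>: the tangential coefficient is zero and the normal one is
    \<open>b\<close>.\<close>
  have xy: "x s = - b * y' s" "y s = b * x' s" if s: "s \<in> I" for s
    using a[OF s] b[OF s] unit[OF s] by algebra+
  show ?thesis
  \<comment> \<open>The value of \<open>k\<close> is forced by \<open>\<kappa> b = - 1\<close>;
    solving \<open>xy\<close> for the velocity then gives rotation at angular speed
    \<open>k\<close>.\<close>
  proof (rule that[of "- 1 / b"])
    fix s assume s: "s \<in> I"
    show "\<kappa> s = - 1 / b"
      using \<kappa>b[OF s] b0 by (simp add: field_simps)
    show "x' s = - (- 1 / b) * y s" "y' s = - 1 / b * x s"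
      using xy[OF s] b0 by simp_all
    show "y s * x' s - x s * y' s = - 1 / (- 1 / b)"
      using b[OF s] by simp
  qed (use b0 in auto)
qed

text \<open>Turning the point back by the angle \<open>k s\<close> cancels the motion: both
  coordinates \<open>u\<close>, \<open>v\<close> of the turned point have derivative zero. Polar
  coordinates of the constant point \<open>(u, v)\<close> supply the radius and the phase.\<close>

lemma polar_form_of_rotation:
  assumes k: "\<And>s. s \<in> I \<Longrightarrow> x' s = - k * y s" "\<And>s. s \<in> I \<Longrightarrow> y' s = k * x s"
  obtains \<rho> \<phi> where "\<rho> > 0" "\<And>s. s \<in> I \<Longrightarrow> x s = \<rho> * cos (k * s + \<phi>)"
    "\<And>s. s \<in> I \<Longrightarrow> y s = \<rho> * sin (k * s + \<phi>)"
proof -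
  have "((\<lambda>s. x s * cos (k * s) + y s * sin (k * s)) has_real_derivative 0) (at s within I)"
    if s: "s \<in> I" for s
    by (rule derivative_eq_intros x y s refl)+ (simp add: k[OF s] algebra_simps)
  then obtain u where u: "\<And>s. s \<in> I \<Longrightarrow> x s * cos (k * s) + y s * sin (k * s) = u"
    using zero_deriv_constant by blast
  have "((\<lambda>s. y s * cos (k * s) - x s * sin (k * s)) has_real_derivative 0) (at s within I)"
    if s: "s \<in> I" for s
    by (rule derivative_eq_intros x y s refl)+ (simp add: k[OF s] algebra_simps)
  then obtain v where v: "\<And>s. s \<in> I \<Longrightarrow> y s * cos (k * s) - x s * sin (k * s) = v"
    using zero_deriv_constant by blast
  define \<rho> where "\<rho> = cmod (Complex u v)"
  define \<phi> where "\<phi> = Arg (Complex u v)"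
  have uv: "u = \<rho> * cos \<phi>" "v = \<rho> * sin \<phi>"
    using rcis_cmod_Arg[of "Complex u v"] unfolding \<rho>_def \<phi>_def
    by (metis Re_rcis complex.sel(1), metis Im_rcis complex.sel(2))
  have xy: "x s = \<rho> * cos (k * s + \<phi>)" "y s = \<rho> * sin (k * s + \<phi>)" if s: "s \<in> I" for s
  proof -
    \<comment> \<open>The rotation by \<open>- k s\<close> is inverted, using that the squares of
      sine and cosine add up to 1.\<close>
    have "x s = u * cos (k * s) - v * sin (k * s)" "y s = u * sin (k * s) + v * cos (k * s)"
      using sin_cos_squared_add[of "k * s"] u[OF s] v[OF s] by algebra+
    then show "x s = \<rho> * cos (k * s + \<phi>)" "y s = \<rho> * sin (k * s + \<phi>)"
      by (simp_all add: uv cos_add sin_add algebra_simps)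
  qed
  \<comment> \<open>A zero radius would keep the point at the origin, where the rotation has zero
    velocity.\<close>
  have "\<rho> \<noteq> 0"
  proof
    assume "\<rho> = 0"
    obtain s where s: "s \<in> I"
      using nonempty by auto
    then have "x' s = 0" "y' s = 0"
      using xy[OF s] k[OF s] \<open>\<rho> = 0\<close> by simp_all
    then show False
      using unit[OF s] by simp
  qed
  then show ?thesis
    using that[of \<rho> \<phi>] xy by (simp add: \<rho>_def)
qed

end

section \<open>Spans of two vectors, images of intervals, components of derivatives\<close>

lemma mem_span_pair_iff: "p \<in> span {u, v} \<longleftrightarrow> (\<exists>\<alpha> \<beta>. p = \<alpha> *\<^sub>R u + \<beta> *\<^sub>R v)"
proof -
  have "p - \<alpha> *\<^sub>R u = \<beta> *\<^sub>R v \<longleftrightarrow> p = \<alpha> *\<^sub>R u + \<beta> *\<^sub>R v" for \<alpha> \<beta>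
    by (simp only: diff_eq_eq add.commute)
  then show ?thesis
    by (simp add: span_breakdown_eq[of p u "{v}"] span_singleton image_iff)
qed

text \<open>Needed for the angle interval of \<open>planar_circle\<close>. The map is an injective
  linear map followed by a translation, and both preserve convexity and nonempty interior.\<close>

lemma affine_image_interval:
  fixes I :: "real set"
  assumes "is_interval I" "interior I \<noteq> {}" "k \<noteq> 0"
  shows "is_interval ((\<lambda>s. k * s + \<phi>) ` I)" "interior ((\<lambda>s. k * s + \<phi>) ` I) \<noteq> {}"
proof -
  have eq: "(\<lambda>s. k * s + \<phi>) ` I = (+) \<phi> ` ((*) k ` I)"
    by (simp add: image_image add.commute)
  have lin: "linear ((*) k)"
    by (simp add: linear_times)
  show "is_interval ((\<lambda>s. k * s + \<phi>) ` I)"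
    using assms(1) unfolding eq is_interval_convex_1
    by (intro convex_translation convex_linear_image lin)
  have "inj ((*) k)"
    using assms(3) by (auto simp: inj_def)
  then show "interior ((\<lambda>s. k * s + \<phi>) ` I) \<noteq> {}"
    using assms(2) unfolding eq interior_translation
    by (simp add: interior_injective_linear_image[OF lin])
qed

lemma has_real_derivative_component:
  fixes g :: "real \<Rightarrow> real ^ 'n"
  assumes "g differentiable at s within I"
  shows "((\<lambda>u. g u $ i) has_real_derivative curve_deriv I g s $ i) (at s within I)"
  using bounded_linear.has_vector_derivative[OF bounded_linear_vec_nth
      vector_derivative_works[THEN iffD1, OF assms]]
  by (simp add: has_real_derivative_iff_has_vector_derivative curve_deriv_def)

theorem theorem5p1:
  fixes I :: "real set" and r :: "real \<Rightarrow> real ^ 3"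
  assumes "is_interval I" and "interior I \<noteq> {}"
    and "smooth_curve I r"
    and "horizontally_regular I r"
    and "horizontal_arc_length I r"
  shows
    "((\<forall>s\<in>I. r s \<in> span {frame_t I r s, frame_n I r s}) \<longrightarrow>
        r ` I \<subseteq> xy_plane \<and>
        ((\<forall>s\<in>I. p_curvature I r s = 0) \<longrightarrow>
           (\<exists>L. is_line L \<and> L \<subseteq> xy_plane \<and> r ` I \<subseteq> L)) \<and>
        (\<not> (\<forall>s\<in>I. p_curvature I r s = 0) \<longrightarrow>
           nonlinear_planar_curve_in xy_plane I r)) \<and>
     ((\<forall>s\<in>I. r s \<in> span {frame_t I r s, frame_b I r s}) \<longrightarrow>
        (\<forall>s\<in>I. p_curvature I r s = 0) \<and>
        (\<exists>P. vertical_plane_through_z_axis P \<and> r ` I \<subseteq> P)) \<and>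
     ((\<forall>s\<in>I. r s \<in> span {frame_n I r s, frame_b I r s}) \<longrightarrow>
        (\<exists>k. k \<noteq> 0 \<and> (\<forall>s\<in>I. p_curvature I r s = k)) \<and>
        (\<exists>c R. R > 0 \<and> xy_proj ` (r ` I) \<subseteq> sphere c R) \<and>
        (\<exists>\<rho>. \<rho> > 0 \<and> r ` I \<subseteq> z_cylinder \<rho>) \<and>
        ((\<exists>A B. \<forall>s\<in>I. r s $ 3 = A * s + B) \<longleftrightarrow> contact_normality I r constant_on I) \<and>
        (contact_normality I r constant_on I \<longrightarrow>
           ((\<lambda>s. r s $ 3) constant_on I \<longrightarrow> planar_circle I r) \<and>
           (\<not> (\<lambda>s. r s $ 3) constant_on I \<longrightarrow> nondegenerate_circular_helix I r)))"
proof -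

  \<comment> \<open>Reduction to the plane projection\<close>
  define r1 where "r1 = curve_deriv I r"
  define r2 where "r2 = curve_deriv I r1"
  \<comment> \<open>The third derivative enters only through the derivative of \<kappa> in the
    second case.\<close>
  define r3 where "r3 = curve_deriv I r2"
  have diff: "(curve_deriv I ^^ n) r differentiable at s within I" if "s \<in> I" for n s
    using that assms(3) by (auto simp: smooth_curve_def differentiable_on_def)
  have d0: "((\<lambda>u. r u $ i) has_real_derivative r1 s $ i) (at s within I)" if "s \<in> I" for s i
    using has_real_derivative_component[OF diff[OF that, of 0]] by (simp add: r1_def)
  have d1: "((\<lambda>u. r1 u $ i) has_real_derivative r2 s $ i) (at s within I)" if "s \<in> I" for s i
    using has_real_derivative_component[OF diff[OF that, of 1]] by (simp add: r1_def r2_def)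
  have d2: "((\<lambda>u. r2 u $ i) has_real_derivative r3 s $ i) (at s within I)" if "s \<in> I" for s i
    using has_real_derivative_component[OF diff[OF that, of 2]]
    by (simp add: r1_def r2_def r3_def numeral_2_eq_2)
  interpret unit_speed_plane_curve I "\<lambda>s. r s $ 1" "\<lambda>s. r s $ 2"
    "\<lambda>s. r1 s $ 1" "\<lambda>s. r1 s $ 2" "\<lambda>s. r2 s $ 1" "\<lambda>s. r2 s $ 2"
    using assms(1,2,5) d0 d1
    by unfold_locales (auto simp: horizontal_arc_length_def r1_def)
  have p_curvature: "p_curvature I r s = \<kappa> s" if "s \<in> I" for s
    using p_curvature_eq[OF assms(1-3) that] unfolding \<kappa>_def by (simp add: r1_def r2_def)
  \<comment> \<open>The bracket is the normal quantity treated by \<open>deriv_normal\<close>; in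
    the third case it is constant, so the contact normality and the slope of the height are constant
    together.\<close>
  have tau: "contact_normality I r s = r1 s $ 3 - (r s $ 2 * r1 s $ 1 - r s $ 1 * r1 s $ 2)" for s
    by (simp add: contact_normality_def contact_form_def r1_def)
  have frame:
    "frame_t I r s = vector [r1 s $ 1, r1 s $ 2, r1 s $ 1 * r s $ 2 - r s $ 1 * r1 s $ 2]"
    "frame_n I r s = vector [- r1 s $ 2, r1 s $ 1, - (r s $ 2 * r1 s $ 2) - r s $ 1 * r1 s $ 1]"
    "frame_b I r s = vector [0, 0, 1]" for s
    by (simp_all add: frame_t_coords frame_n_coords frame_b_def frame_T_def r1_def)

  \<comment> \<open>Position spanned by t and n\<close>
  have part1: "r ` I \<subseteq> xy_plane \<and>
        ((\<forall>s\<in>I. p_curvature I r s = 0) \<longrightarrow>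
           (\<exists>L. is_line L \<and> L \<subseteq> xy_plane \<and> r ` I \<subseteq> L)) \<and>
        (\<not> (\<forall>s\<in>I. p_curvature I r s = 0) \<longrightarrow>
           nonlinear_planar_curve_in xy_plane I r)"
    if span: "\<forall>s\<in>I. r s \<in> span {frame_t I r s, frame_n I r s}"
  proof (intro conjI impI)
    have z: "r s $ 3 = 0" if s: "s \<in> I" for s
    proof -
      obtain \<alpha> \<beta> where ab: "r s = \<alpha> *\<^sub>R frame_t I r s + \<beta> *\<^sub>R frame_n I r s"
        using span[rule_format, OF s] unfolding mem_span_pair_iff by blast
      show ?thesis
        \<comment> \<open>Let \<open>w\<close> be the squared length of the planar velocity. The
          first two coordinates give \<open>x' y - x y' = \<beta> w\<close> and
          \<open>x x' + y y' = \<alpha> w\<close>, so the third one reads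
          \<open>z = \<alpha> \<beta> w - \<beta> \<alpha> w\<close>.\<close>
        using arg_cong[OF ab, of "\<lambda>p. p $ 1"] arg_cong[OF ab, of "\<lambda>p. p $ 2"]
          arg_cong[OF ab, of "\<lambda>p. p $ 3"]
        unfolding frame vector_add_component vector_scaleR_component vector_3 real_scaleR_def
        by algebra
    qed
    then show xy: "r ` I \<subseteq> xy_plane"
      by (auto simp: xy_plane_def)
    show "\<exists>L. is_line L \<and> L \<subseteq> xy_plane \<and> r ` I \<subseteq> L" if flat: "\<forall>s\<in>I. p_curvature I r s = 0"
    proof -
      have \<kappa>0: "\<kappa> s = 0" if "s \<in> I" for s
        using flat p_curvature that by simp
      obtain a b c d where l: "c\<^sup>2 + d\<^sup>2 = 1"
        "\<And>s. s \<in> I \<Longrightarrow> r s $ 1 = a + c * s" "\<And>s. s \<in> I \<Longrightarrow> r s $ 2 = b + d * s"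
        using zero_curvature_line[OF \<kappa>0] that by metis
      \<comment> \<open>The second point is the first one shifted by the velocity, so
        \<open>s\<close> itself is the affine parameter on the line.\<close>
      let ?p = "vector [a, b, 0] :: real ^ 3" and ?q = "vector [a + c, b + d, 0] :: real ^ 3"
      have "?p \<noteq> ?q"
        using l(1) by (auto simp: vec_eq_iff forall_3 vector_3)
      then have "is_line (affine hull {?p, ?q})"
        by (auto simp: is_line_def)
      moreover have "affine hull {?p, ?q} \<subseteq> xy_plane"
        by (auto simp: affine_hull_2 xy_plane_def vector_3)
      moreover have "r s \<in> affine hull {?p, ?q}" if s: "s \<in> I" for s
      proof -
        have "r s = (1 - s) *\<^sub>R ?p + s *\<^sub>R ?q"
          using l(2,3)[OF s] z[OF s] by (simp add: vec_eq_iff forall_3 vector_3 algebra_simps)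
        then show ?thesis
          unfolding affine_hull_2 by force
      qed
      ultimately show ?thesis
        by blast
    qed
    show "nonlinear_planar_curve_in xy_plane I r" if "\<not> (\<forall>s\<in>I. p_curvature I r s = 0)"
      unfolding nonlinear_planar_curve_in_def
    proof (intro conjI notI xy)
      assume "\<exists>L. is_line L \<and> r ` I \<subseteq> L"
      then obtain p q where pq: "r ` I \<subseteq> affine hull {p, q}"
        by (auto simp: is_line_def)
      have "\<exists>v. r s = p + v *\<^sub>R (q - p)" if s: "s \<in> I" for s
      proof -
        obtain u v where uv: "r s = u *\<^sub>R p + v *\<^sub>R q" "u + v = 1"
          using pq s by (auto simp: affine_hull_2)
        then have u: "u = 1 - v"
          by simp
        have "r s = p + v *\<^sub>R (q - p)"
          unfolding uv(1) u by (simp add: algebra_simps)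
        then show ?thesis ..
      qed
      then obtain t where t: "\<And>s. s \<in> I \<Longrightarrow> r s = p + t s *\<^sub>R (q - p)"
        by metis
      have "\<kappa> s = 0" if "s \<in> I" for s
        by (rule zero_curvature_if_in_line[where p = "p $ 1" and q = "p $ 2" and t = t
              and c = "(q - p) $ 1" and d = "(q - p) $ 2", OF _ that]) (simp add: t)
      then show False
        using that p_curvature by auto
    qed
  qed

  \<comment> \<open>Position spanned by t and b\<close>
  have part2: "(\<forall>s\<in>I. p_curvature I r s = 0) \<and>
        (\<exists>P. vertical_plane_through_z_axis P \<and> r ` I \<subseteq> P)"
    if span: "\<forall>s\<in>I. r s \<in> span {frame_t I r s, frame_b I r s}"
  proof -
    have b: "r s $ 2 * r1 s $ 1 - r s $ 1 * r1 s $ 2 = 0" if s: "s \<in> I" for s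
    proof -
      obtain \<alpha> \<beta> where ab: "r s = \<alpha> *\<^sub>R frame_t I r s + \<beta> *\<^sub>R frame_b I r s"
        using span[rule_format, OF s] unfolding mem_span_pair_iff by blast
      show ?thesis
        \<comment> \<open>The vector b is vertical, so the projected position is \<alpha> times the
          projected velocity and their determinant vanishes.\<close>
        using arg_cong[OF ab, of "\<lambda>p. p $ 1"] arg_cong[OF ab, of "\<lambda>p. p $ 2"]
        unfolding frame vector_add_component vector_scaleR_component vector_3 real_scaleR_def
        by algebra
    qed
    have "(\<kappa> has_real_derivative r1 s $ 1 * r3 s $ 2 - r3 s $ 1 * r1 s $ 2) (at s within I)"
      if s: "s \<in> I" for s
      unfolding \<kappa>_def
      by (rule derivative_eq_intros d1 d2 s refl)+ (simp add: algebra_simps)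
    then have \<kappa>0: "\<kappa> s = 0" if "s \<in> I" for s
      by (rule zero_curvature_if_radial[OF _ b that])
    obtain c d where cd: "c\<^sup>2 + d\<^sup>2 = 1" "\<And>s. s \<in> I \<Longrightarrow> r1 s $ 1 = c" "\<And>s. s \<in> I \<Longrightarrow> r1 s $ 2 = d"
      using zero_curvature_direction[OF \<kappa>0] that by metis
    \<comment> \<open>Once the velocity is the constant \<open>(c, d)\<close>, the vanishing
      determinant \<open>b\<close> is exactly the equation of this plane.\<close>
    let ?P = "{p :: real ^ 3. - d * p $ 1 + c * p $ 2 = 0}"
    have "- d \<noteq> 0 \<or> c \<noteq> 0"
      using cd(1) by auto
    then have "vertical_plane_through_z_axis ?P"
      unfolding vertical_plane_through_z_axis_def by blast
    moreover have "r ` I \<subseteq> ?P"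
      using b cd by (auto simp: algebra_simps)
    ultimately have "\<exists>P. vertical_plane_through_z_axis P \<and> r ` I \<subseteq> P"
      by blast
    then show ?thesis
      using \<kappa>0 p_curvature by simp
  qed

  \<comment> \<open>Position spanned by n and b\<close>
  have part3: "(\<exists>k. k \<noteq> 0 \<and> (\<forall>s\<in>I. p_curvature I r s = k)) \<and>
        (\<exists>c R. R > 0 \<and> xy_proj ` (r ` I) \<subseteq> sphere c R) \<and>
        (\<exists>\<rho>. \<rho> > 0 \<and> r ` I \<subseteq> z_cylinder \<rho>) \<and>
        ((\<exists>A B. \<forall>s\<in>I. r s $ 3 = A * s + B) \<longleftrightarrow> contact_normality I r constant_on I) \<and>
        (contact_normality I r constant_on I \<longrightarrow>
           ((\<lambda>s. r s $ 3) constant_on I \<longrightarrow> planar_circle I r) \<and>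
           (\<not> (\<lambda>s. r s $ 3) constant_on I \<longrightarrow> nondegenerate_circular_helix I r))"
    if span: "\<forall>s\<in>I. r s \<in> span {frame_n I r s, frame_b I r s}"
  proof -
    have a: "r s $ 1 * r1 s $ 1 + r s $ 2 * r1 s $ 2 = 0" if s: "s \<in> I" for s
    proof -
      obtain \<alpha> \<beta> where ab: "r s = \<alpha> *\<^sub>R frame_n I r s + \<beta> *\<^sub>R frame_b I r s"
        using span[rule_format, OF s] unfolding mem_span_pair_iff by blast
      \<comment> \<open>The projected position is a multiple of the planar normal, hence orthogonal
        to the velocity.\<close>
      show ?thesis
        using arg_cong[OF ab, of "\<lambda>p. p $ 1"] arg_cong[OF ab, of "\<lambda>p. p $ 2"]
        unfolding frame vector_add_component vector_scaleR_component vector_3 real_scaleR_def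
        by algebra
    qed
    obtain k where k: "k \<noteq> 0" "\<And>s. s \<in> I \<Longrightarrow> \<kappa> s = k"
      "\<And>s. s \<in> I \<Longrightarrow> r1 s $ 1 = - k * r s $ 2" "\<And>s. s \<in> I \<Longrightarrow> r1 s $ 2 = k * r s $ 1"
      "\<And>s. s \<in> I \<Longrightarrow> r s $ 2 * r1 s $ 1 - r s $ 1 * r1 s $ 2 = - 1 / k"
      using rotation_if_tangential_zero[OF a] that by metis
    obtain \<rho> \<phi> where \<rho>: "\<rho> > 0" "\<And>s. s \<in> I \<Longrightarrow> r s $ 1 = \<rho> * cos (k * s + \<phi>)"
      "\<And>s. s \<in> I \<Longrightarrow> r s $ 2 = \<rho> * sin (k * s + \<phi>)"
      using polar_form_of_rotation[OF k(3,4)] that by metis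
    have norm: "(r s $ 1)\<^sup>2 + (r s $ 2)\<^sup>2 = \<rho>\<^sup>2" if "s \<in> I" for s
      by (simp add: \<rho>(2,3)[OF that] power_mult_distrib flip: distrib_left)
    have "xy_proj ` (r ` I) \<subseteq> sphere 0 \<rho>"
      using norm \<rho>(1) by (auto simp: xy_proj_def norm_vec_def L2_set_def sum_2)
    then have circle: "\<exists>c R. R > 0 \<and> xy_proj ` (r ` I) \<subseteq> sphere c R"
      using \<rho>(1) by blast
    have "r ` I \<subseteq> z_cylinder \<rho>"
      using norm by (auto simp: z_cylinder_def)
    then have cylinder: "\<exists>\<rho>. \<rho> > 0 \<and> r ` I \<subseteq> z_cylinder \<rho>"
      using \<rho>(1) by blast
    have curvature: "\<exists>k. k \<noteq> 0 \<and> (\<forall>s\<in>I. p_curvature I r s = k)"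
      using k(1,2) p_curvature by auto
    have affine_iff:
      "(\<exists>A B. \<forall>s\<in>I. r s $ 3 = A * s + B) \<longleftrightarrow> contact_normality I r constant_on I"
    proof
      assume "\<exists>A B. \<forall>s\<in>I. r s $ 3 = A * s + B"
      then obtain A B where AB: "\<And>s. s \<in> I \<Longrightarrow> r s $ 3 = A * s + B"
        by blast
      have "r1 s $ 3 = A" if s: "s \<in> I" for s
        by (rule deriv_eq[OF s d0[OF s] _ AB]) (rule derivative_eq_intros refl | simp)+
      then show "contact_normality I r constant_on I"
        using k(5) by (auto simp: constant_on_def tau)
    next
      assume "contact_normality I r constant_on I"
      then obtain T where const: "\<And>s. s \<in> I \<Longrightarrow> contact_normality I r s = T"
        by (auto simp: constant_on_def)
      \<comment> \<open>The bracket in \<open>tau\<close> equals \<open>- 1 / k\<close>, so the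
        contact normality is \<open>z' + 1 / k\<close>; this determines the slope of the
        height.\<close>
      then have T: "r1 s $ 3 = T - 1 / k" if "s \<in> I" for s
        using k(5)[OF that] const[OF that] unfolding tau by simp
      have "((\<lambda>s. r s $ 3 - (T - 1 / k) * s) has_real_derivative 0) (at s within I)"
        if s: "s \<in> I" for s
        by (rule derivative_eq_intros d0 s refl)+ (simp add: T[OF s])
      then obtain B where "\<And>s. s \<in> I \<Longrightarrow> r s $ 3 - (T - 1 / k) * s = B"
        using zero_deriv_constant by blast
      then have "\<forall>s\<in>I. r s $ 3 = (T - 1 / k) * s + B"
        by (simp add: algebra_simps)
      then show "\<exists>A B. \<forall>s\<in>I. r s $ 3 = A * s + B"
        by blast
    qed
    have planar: "planar_circle I r" if const: "(\<lambda>s. r s $ 3) constant_on I"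
    proof -
      obtain h where h: "\<And>s. s \<in> I \<Longrightarrow> r s $ 3 = h"
        using const by (auto simp: constant_on_def)
      \<comment> \<open>The angles actually swept, so that the trace is equal to the arc and not
        merely contained in the circle.\<close>
      let ?J = "(\<lambda>s. k * s + \<phi>) ` I"
      \<comment> \<open>The summands \<open>0\<close> are the coordinates of the centre, kept to
        match the form in \<open>planar_circle\<close>.\<close>
      have "r s = vector [0 + \<rho> * cos (k * s + \<phi>), 0 + \<rho> * sin (k * s + \<phi>), h]" if "s \<in> I" for s
        using \<rho>(2,3)[OF that] h[OF that] by (simp add: vec_eq_iff forall_3 vector_3)
      then have image: "r ` I = (\<lambda>\<theta>. vector [0 + \<rho> * cos \<theta>, 0 + \<rho> * sin \<theta>, h]) ` ?J"
        unfolding image_image by (rule image_cong[OF refl])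
      show ?thesis
        unfolding planar_circle_def
        by (rule exI[of _ 0], rule exI[of _ 0], rule exI[of _ h], rule exI[of _ \<rho>],
            rule exI[of _ ?J]) (intro conjI \<rho>(1) affine_image_interval[OF I k(1)] image)
    qed
    have helix: "nondegenerate_circular_helix I r"
      if tau_const: "contact_normality I r constant_on I" and nconst: "\<not> (\<lambda>s. r s $ 3) constant_on I"
    proof -
      obtain A B where AB: "\<And>s. s \<in> I \<Longrightarrow> r s $ 3 = A * s + B"
        using affine_iff tau_const by blast
      have A: "A \<noteq> 0"
        using nconst AB by (auto simp: constant_on_def)
      have helix: "r s = vector [\<rho> * cos (k * s + \<phi>), \<rho> * sin (k * s + \<phi>), A * s + B]"
        if "s \<in> I" for s
        using \<rho>(2,3)[OF that] AB[OF that] by (simp add: vec_eq_iff forall_3 vector_3)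
      show ?thesis
        unfolding nondegenerate_circular_helix_def
        by (rule exI[of _ \<rho>], rule exI[of _ k], rule exI[of _ \<phi>], rule exI[of _ A],
            rule exI[of _ B]) (intro conjI ballI \<rho>(1) k(1) A helix)
    qed
    show ?thesis
      by (intro conjI impI curvature circle cylinder affine_iff planar helix)
  qed

  show ?thesis
    \<comment> \<open>This instance of \<open>conjI\<close> separates only the three implications;
      their conclusions stay whole and match \<open>part1\<close>, \<open>part2\<close> and
      \<open>part3\<close>.\<close>
    by (intro conjI[of "_ \<longrightarrow> _"] impI part1 part2 part3)
qed

end
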